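(* Let $\Sigma=(A,B,C,D,E,\mathsf{R})$ and $\hat\Sigma=(\hat A,\hat B,\hat C,\hat D,\hat E,\hat{\mathsf{R}})$ be two jump linear stochastic systems with $p=\hat p$ and $q=\hat q$, where $\mathsf{R}=\{R_1,\dots,R_{\widetilde q}\}$ and $\hat{\mathsf{R}}=\{\hat R_1,\dots,\hat R_{\widetilde q}\}$. Suppose that for some constant $\widehat\kappa\in\mathbb{R}_{>0}$ there exist a positive definite matrix $M\in\mathbb{R}^{n\times n}$ and matrices $K\in\mathbb{R}^{m\times n}$, $P\in\mathbb{R}^{n\times\hat n}$, $Q\in\mathbb{R}^{m\times\hat n}$, $S\in\mathbb{R}^{m\times p}$ satisfying $$C^TC\preceq M,$$ $$\Big(A+BK+\sum_{i=1}^{\widetilde q}\lambda_iR_i\Big)^TM+M\Big(A+BK+\sum_{i=1}^{\widetilde q}\lambda_iR_i\Big)+E^TME+\sum_{i=1}^{\widetilde q}\lambda_iR_i^TMR_i\preceq-\widehat\kappa M,$$ and $$AP=P\hat A-BQ,\quad D=P\hat D-BS,\quad CP=\hat C,\quad EP=P\hat E,\quad R_iP=P\hat R_i\ \ \forall i\in\{1,\dots,\widetilde q\}.$$ Then $V(x,\hat x)=(x-P\hat x)^TM(x-P\hat x)$ is an SSF-M$_2$ function from $\hat\Sigma$ to $\Sigma$.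
   Context: Noise. $(\Omega,\mathcal{F},\mathbb{P})$ is a probability space with a filtration $\mathbb{F}$ satisfying the usual conditions; $W$ is a scalar $\mathbb{F}$-Brownian motion and $(P^1_t,\dots,P^{\widetilde q}_t)$ are independent $\mathbb{F}$-Poisson processes with rates $\lambda_1,\dots,\lambda_{\widetilde q}$, independent of $W$. Both systems are driven by the same noises. Jump linear stochastic system (JLSS). $\Sigma=(A,B,C,D,E,\mathsf{R})$ with $A\in\mathbb{R}^{n\times n}$, $B\in\mathbb{R}^{n\times m}$, $C\in\mathbb{R}^{q\times n}$, $D\in\mathbb{R}^{n\times p}$, $E\in\mathbb{R}^{n\times n}$, $R_i\in\mathbb{R}^{n\times n}$ denotes the system $$d\xi(t)=(A\xi(t)+B\nu(t)+D\omega(t))\,dt+E\xi(t)\,dW_t+\sum_{i=1}^{\widetilde q}R_i\xi(t)\,dP^i_t,\qquad \zeta(t)=C\xi(t),$$ with external input $\nu$ ($\mathbb{R}^m$-valued) and internal input $\omega$ ($\mathbb{R}^p$-valued). $\hat\Sigma$ has state, external input, internal input and output dimensions $\hat n,\hat m,\hat p,\hat q$. Infinitesimal generator. For $C^2$ $V:\mathbb{R}^n\times\mathbb{R}^{\hat n}\to\mathbb{R}_{\ge0}$ and these systems, $$\mathcal{L}V(x,\hat x)=\partial_xV\,(Ax+Bu+Dw)+\partial_{\hat x}V\,(\hat A\hat x+\hat B\hat u+\hat D\hat w)+\frac12\mathrm{Tr}\left(\begin{bmatrix}Ex\\ \hat E\hat x\end{bmatrix}[x^TE^T\ \ \hat x^T\hat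 E^T]\begin{bmatrix}\partial_{x,x}V&\partial_{x,\hat x}V\\ \partial_{\hat x,x}V&\partial_{\hat x,\hat x}V\end{bmatrix}\right)+\sum_{i=1}^{\widetilde q}\lambda_i\big(V(x+R_ix,\hat x+\hat R_i\hat x)-V(x,\hat x)\big).$$ SSF-M$_2$ function. A $\mathcal{K}_\infty$ function is a continuous strictly increasing $\gamma:\mathbb{R}_{\ge0}\to\mathbb{R}_{\ge0}$ with $\gamma(0)=0$ and $\gamma(s)\to\infty$ as $s\to\infty$. A twice continuously differentiable $V:\mathbb{R}^n\times\mathbb{R}^{\hat n}\to\mathbb{R}_{\ge0}$ is a stochastic simulation function from $\hat\Sigma$ to $\Sigma$ in the second moment (SSF-M$_2$) if it has polynomial growth rate and there are $\mathcal{K}_\infty$ functions $\alpha,\eta,\rho_{\mathrm{ext}},\rho_{\mathrm{int}}$, with $\alpha,\eta$ convex and $\rho_{\mathrm{ext}},\rho_{\mathrm{int}}$ concave, such that for all $x\in\mathbb{R}^n$, $\hat x\in\mathbb{R}^{\hat n}$: (i) $\alpha(\Vert Cx-\hat C\hat x\Vert^2)\le V(x,\hat x)$; (ii) $\forall\hat u\in\mathbb{R}^{\hat m}\ \forall\hat w\in\mathbb{R}^p\ \exists u\in\mathbb{R}^m\ \forall w\in\mathbb{R}^p$: $\mathcal{L}V(x,\hat x)\le-\eta(V(x,\hat x))+\rho_{\mathrm{ext}}(\Vert\hat u\Vert^2)+\rho_{\mathrm{int}}(\Vert w-\hat w\Vert^2)$. Here $\Vert\cdot\Vert$ is the Euclidean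 norm and $X\preceq Y$ means $Y-X$ is positive semidefinite. *)

theory Defs
  imports "HOL-Analysis.Analysis"
begin

text \<open>
  The system d xi = (A xi + B nu + D omega) dt + E xi dW + sum of R i xi dP i over i = 1, ..., N,
  with output zeta = C xi; only the matrices with index in \<open>{1..N}\<close> of the family \<open>R_mat\<close> matter.
  The type arguments index the state, external input, internal input and output spaces.
\<close>

record ('n::finite, 'm::finite, 'p::finite, 'q::finite) jlss =
  A_mat :: "real^'n^'n"
  B_mat :: "real^'m^'n"
  C_mat :: "real^'n^'q"
  D_mat :: "real^'p^'n"
  E_mat :: "real^'n^'n"
  R_mat :: "nat \<Rightarrow> real^'n^'n"

definition pos_definite :: "real^'n^'n \<Rightarrow> bool" where
  "pos_definite X \<longleftrightarrow> transpose X = X \<and> (\<forall>v. v \<noteq> 0 \<longrightarrow> 0 < v \<bullet> (X *v v))"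

definition pos_semidefinite :: "real^'n^'n \<Rightarrow> bool" where
  "pos_semidefinite X \<longleftrightarrow> transpose X = X \<and> (\<forall>v. 0 \<le> v \<bullet> (X *v v))"

definition loewner_le :: "real^'n^'n \<Rightarrow> real^'n^'n \<Rightarrow> bool"  (infix "\<preceq>" 50) where
  "X \<preceq> Y \<longleftrightarrow> pos_semidefinite (Y - X)"

definition twice_cont_differentiable ::
  "('a::real_normed_vector \<Rightarrow> 'b::real_normed_vector) \<Rightarrow> bool" where
  "twice_cont_differentiable f \<longleftrightarrow>
     (\<exists>(f' :: 'a \<Rightarrow> 'a \<Rightarrow>\<^sub>L 'b) (f'' :: 'a \<Rightarrow> 'a \<Rightarrow>\<^sub>L ('a \<Rightarrow>\<^sub>L 'b)).
        (\<forall>z. (f has_derivative blinfun_apply (f' z)) (at z)) \<and>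
        (\<forall>z. (f' has_derivative blinfun_apply (f'' z)) (at z)) \<and>
        continuous_on UNIV f'')"

definition polynomial_growth :: "('a::real_normed_vector \<Rightarrow> real) \<Rightarrow> bool" where
  "polynomial_growth f \<longleftrightarrow> (\<exists>(c::real) (k::nat). \<forall>z. \<bar>f z\<bar> \<le> c * (1 + norm z ^ k))"

text \<open>Functions on the nonnegative reals are represented by their restriction to \<open>{0..}\<close>.\<close>

definition class_K_inf :: "(real \<Rightarrow> real) \<Rightarrow> bool" where
  "class_K_inf g \<longleftrightarrow> continuous_on {0..} g \<and> strict_mono_on {0..} g \<and> g 0 = 0 \<and>
     filterlim g at_top at_top"

definition partial1 :: "'n \<Rightarrow> (real^'n \<Rightarrow> real^'k \<Rightarrow> real) \<Rightarrow> real^'n \<Rightarrow> real^'k \<Rightarrow> real" where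
  "partial1 i V x y = deriv (\<lambda>t. V (x + t *\<^sub>R axis i 1) y) 0"

definition partial2 :: "'k \<Rightarrow> (real^'n \<Rightarrow> real^'k \<Rightarrow> real) \<Rightarrow> real^'n \<Rightarrow> real^'k \<Rightarrow> real" where
  "partial2 j V x y = deriv (\<lambda>t. V x (y + t *\<^sub>R axis j 1)) 0"

text \<open>
  The sum type \<open>'n + 'k\<close> indexes the coordinates of the stacked vector of \<open>x\<close> and \<open>y\<close>,
  so that the block matrices of the generator are ordinary matrices over this index type.
\<close>

definition stack :: "real^'n \<Rightarrow> real^'k \<Rightarrow> real^('n + 'k)" where
  "stack x y = (\<chi> s. case s of Inl i \<Rightarrow> x $ i | Inr j \<Rightarrow> y $ j)"

definition partial ::
  "'n + 'k \<Rightarrow> (real^'n \<Rightarrow> real^'k \<Rightarrow> real) \<Rightarrow> real^'n \<Rightarrow> real^'k \<Rightarrow> real" where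
  "partial s V = (case s of Inl i \<Rightarrow> partial1 i V | Inr j \<Rightarrow> partial2 j V)"

definition hessian :: "(real^'n \<Rightarrow> real^'k \<Rightarrow> real) \<Rightarrow> real^'n \<Rightarrow> real^'k \<Rightarrow> real^('n + 'k)^('n + 'k)" where
  "hessian V x y = (\<chi> s t. partial s (partial t V) x y)"

text \<open>
  The driving noises (one Brownian motion and \<open>N\<close> Poisson processes, shared by both systems)
  enter the generator, and hence simulation functions, only through \<open>N\<close> and the Poisson
  rates \<open>rate 1, ..., rate N\<close>.
\<close>

definition generator ::
  "nat \<Rightarrow> (nat \<Rightarrow> real) \<Rightarrow> ('n::finite, 'm::finite, 'p::finite, 'q::finite) jlss \<Rightarrow>
   ('nh::finite, 'mh::finite, 'ph::finite, 'qh::finite) jlss \<Rightarrow>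
   (real^'n \<Rightarrow> real^'nh \<Rightarrow> real) \<Rightarrow>
   real^'n \<Rightarrow> real^'nh \<Rightarrow> real^'m \<Rightarrow> real^'mh \<Rightarrow> real^'p \<Rightarrow> real^'ph \<Rightarrow> real" where
  "generator N rate Sys SysH V x xh u uh w wh =
     (\<chi> i. partial1 i V x xh) \<bullet> (A_mat Sys *v x + B_mat Sys *v u + D_mat Sys *v w)
   + (\<chi> j. partial2 j V x xh) \<bullet> (A_mat SysH *v xh + B_mat SysH *v uh + D_mat SysH *v wh)
   + 1/2 * trace
       ((columnvector (stack (E_mat Sys *v x) (E_mat SysH *v xh)) :: real^1^('n + 'nh))
        ** (rowvector (stack (E_mat Sys *v x) (E_mat SysH *v xh)) :: real^('n + 'nh)^1)
        ** hessian V x xh)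
   + (\<Sum>i = 1..N. rate i *
        (V (x + R_mat Sys i *v x) (xh + R_mat SysH i *v xh) - V x xh))"

text \<open>\<open>SSF_M2 N rate SysH Sys V\<close>: \<open>V\<close> is a simulation function from \<open>SysH\<close> to \<open>Sys\<close>.\<close>

definition SSF_M2 ::
  "nat \<Rightarrow> (nat \<Rightarrow> real) \<Rightarrow> ('nh::finite, 'mh::finite, 'p::finite, 'q::finite) jlss \<Rightarrow>
   ('n::finite, 'm::finite, 'p, 'q) jlss \<Rightarrow> (real^'n \<Rightarrow> real^'nh \<Rightarrow> real) \<Rightarrow> bool" where
  "SSF_M2 N rate SysH Sys V \<longleftrightarrow>
     (\<forall>x xh. 0 \<le> V x xh) \<and>
     twice_cont_differentiable (\<lambda>(x, xh). V x xh) \<and>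
     polynomial_growth (\<lambda>(x, xh). V x xh) \<and>
     (\<exists>\<alpha> \<eta> \<rho>ext \<rho>int.
        class_K_inf \<alpha> \<and> class_K_inf \<eta> \<and> class_K_inf \<rho>ext \<and> class_K_inf \<rho>int \<and>
        convex_on {0..} \<alpha> \<and> convex_on {0..} \<eta> \<and>
        concave_on {0..} \<rho>ext \<and> concave_on {0..} \<rho>int \<and>
        (\<forall>x xh. \<alpha> ((norm (C_mat Sys *v x - C_mat SysH *v xh))\<^sup>2) \<le> V x xh \<and>
          (\<forall>uh wh. \<exists>u. \<forall>w.
             generator N rate Sys SysH V x xh u uh w wh
               \<le> - \<eta> (V x xh) + \<rho>ext ((norm uh)\<^sup>2) + \<rho>int ((norm (w - wh))\<^sup>2))))"

end

theory Submission
  imports Defs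
begin

text \<open>
  Below, a trailing \<open>h\<close> marks what belongs to the abstract system \<open>SysH\<close>.
  Everything reduces to the error \<open>e = x - P xh\<close>. The matching equations say
  that \<open>P\<close> intertwines the two systems up to terms in the range of \<open>B\<close>, which the input can
  cancel: for \<open>u = K e + Q xh + S wh\<close> the error has drift
  \<open>(A + B K) e + D (w - wh) - P Bh uh\<close>, diffusion \<open>E e\<close> and jumps \<open>R\<^sub>i e\<close>. Both
  states occur only through \<open>e\<close>. Since \<open>V\<close> is the quadratic form of \<open>M\<close> in \<open>e\<close>, its generator is,
  apart from the input terms, also a quadratic form in \<open>e\<close>. The jump terms contribute a part \<open>\<lambda>\<^sub>i 2 (e \<bullet> M R\<^sub>i e)\<close> that looks like
  drift, whence the summand \<open>\<lambda>\<^sub>i R\<^sub>i\<close> in \<open>F\<close>, and the matrix inequality bounds all terms without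
  input by \<open>- \<kappa> V\<close>.

  What remains is the pairing of \<open>M e\<close> with the two input terms. Young's inequality
  (\<open>young_quadratic_form\<close>), used on each with weight \<open>\<kappa> / 4\<close>, costs half of the decay
  rate and leaves multiples of \<open>\<parallel>w - wh\<parallel>\<^sup>2\<close> and \<open>\<parallel>uh\<parallel>\<^sup>2\<close>. So \<open>\<alpha>\<close> may be
  the identity and \<open>\<eta>\<close> and both gains may be linear. The computation of the generator itself is
  \<open>generator_quadratic_error\<close>.
\<close>

section \<open>Quadratic forms\<close>

lemma symmetric_inner_commute:
  fixes M :: "real^'n^'n"
  assumes "transpose M = M"
  shows "a \<bullet> (M *v b) = b \<bullet> (M *v a)"
proof -
  have "a \<bullet> (M *v b) = (transpose M *v a) \<bullet> b"
    by (simp only: dot_lmul_matrix transpose_matrix_vector)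
  then show ?thesis
    by (simp add: assms inner_commute)
qed

lemma quadratic_form_add:
  fixes M :: "real^'n^'n"
  assumes "transpose M = M"
  shows "(a + b) \<bullet> (M *v (a + b)) = a \<bullet> (M *v a) + 2 * (b \<bullet> (M *v a)) + b \<bullet> (M *v b)"
  using symmetric_inner_commute[OF assms, of a b]
  by (simp add: matrix_vector_right_distrib inner_add_left inner_add_right)

lemma inner_congruence:
  fixes X :: "real^'n^'m" and M :: "real^'m^'m"
  shows "v \<bullet> ((transpose X ** M ** X) *v v) = (X *v v) \<bullet> (M *v (X *v v))"
  by (simp only: matrix_vector_mul_assoc[symmetric] dot_lmul_matrix[symmetric]
      vector_transpose_matrix)

lemma sum_matrix_vector_mult:
  fixes G :: "'i \<Rightarrow> real^'n^'m"
  shows "(\<Sum>i\<in>I. G i) *v v = (\<Sum>i\<in>I. G i *v v)"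
  by (induction I rule: infinite_finite_induct) (simp_all add: matrix_vector_mult_add_rdistrib)

lemma loewner_leD: "X \<preceq> Y \<Longrightarrow> v \<bullet> (X *v v) \<le> v \<bullet> (Y *v v)"
  by (auto simp: loewner_le_def pos_semidefinite_def matrix_vector_mult_diff_rdistrib
      inner_diff_right)

lemma pos_definite_inner_nonneg: "pos_definite M \<Longrightarrow> 0 \<le> v \<bullet> (M *v v)"
  by (cases "v = 0") (auto simp: pos_definite_def less_imp_le)

text \<open>
  Expand the form at \<open>\<epsilon> a - b\<close>, which is nonnegative, and divide by \<open>\<epsilon>\<close>.
\<close>

lemma young_quadratic_form:
  fixes M :: "real^'n^'n"
  assumes "pos_definite M" and "0 < \<epsilon>"
  shows "2 * (b \<bullet> (M *v a)) \<le> \<epsilon> * (a \<bullet> (M *v a)) + (b \<bullet> (M *v b)) / \<epsilon>"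
proof -
  have sym: "transpose M = M"
    using assms(1) by (simp add: pos_definite_def)
  have "0 \<le> (\<epsilon> *\<^sub>R a + - b) \<bullet> (M *v (\<epsilon> *\<^sub>R a + - b))"
    by (rule pos_definite_inner_nonneg[OF assms(1)])
  also have "\<dots> = \<epsilon> * (\<epsilon> * (a \<bullet> (M *v a)) + (b \<bullet> (M *v b)) / \<epsilon> - 2 * (b \<bullet> (M *v a)))"
    using assms(2) symmetric_inner_commute[OF sym, of a b]
    by (simp add: quadratic_form_add[OF sym] matrix_vector_mult_scaleR algebra_simps
        linear_neg[OF matrix_vector_mul_linear])
  finally show ?thesis
    using assms(2) by (simp add: zero_le_mult_iff)
qed

lemma quadratic_form_bound:
  fixes M :: "real^'n^'n" and L :: "'a::real_normed_vector \<Rightarrow> real^'n"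
  assumes "bounded_linear L"
  obtains c where "0 < c" and "\<And>z. \<bar>L z \<bullet> (M *v L z)\<bar> \<le> c * (norm z)\<^sup>2"
proof -
  obtain k where k: "0 < k" "\<And>z. norm (L z) \<le> norm z * k"
    using bounded_linear.pos_bounded[OF assms] by blast
  have "bounded_linear (\<lambda>z. M *v L z)"
    using bounded_linear_compose[OF matrix_vector_mul_bounded_linear assms] .
  then obtain l where l: "0 < l" "\<And>z. norm (M *v L z) \<le> norm z * l"
    using bounded_linear.pos_bounded by blast
  have "\<bar>L z \<bullet> (M *v L z)\<bar> \<le> (k * l) * (norm z)\<^sup>2" for z
  proof -
    have "\<bar>L z \<bullet> (M *v L z)\<bar> \<le> norm (L z) * norm (M *v L z)"
      by (rule Cauchy_Schwarz_ineq2)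
    also have "\<dots> \<le> (norm z * k) * (norm z * l)"
      using k l by (intro mult_mono) auto
    finally show ?thesis
      by (simp add: power2_eq_square mult_ac)
  qed
  with k(1) l(1) show thesis
    by (intro that[of "k * l"]) auto
qed

section \<open>Regularity of the simulation function\<close>

text \<open>
  The derivative is itself a bounded linear function of the base point, so that the second
  derivative is constant and its continuity trivial.
\<close>

lemma twice_cont_differentiable_quadratic_form:
  fixes M :: "real^'n^'n" and L :: "'a::real_normed_vector \<Rightarrow> real^'n"
  assumes "bounded_linear L" and sym: "transpose M = M"
  shows "twice_cont_differentiable (\<lambda>z. L z \<bullet> (M *v L z))"
proof -
  define f' where
    "f' z = blinfun_inner_right (2 *\<^sub>R (M *v L z)) o\<^sub>L Blinfun L" for z
  have grad: "bounded_linear (\<lambda>z. M *v L z)"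
    using bounded_linear_compose[OF matrix_vector_mul_bounded_linear assms(1)] .
  have lin: "bounded_linear f'"
    unfolding f'_def
    by (intro bounded_linear_compose[OF bounded_bilinear.bounded_linear_left
          [OF bounded_bilinear_blinfun_compose]]
        bounded_linear_compose[OF bounded_linear_blinfun_inner_right]
        bounded_linear_compose[OF bounded_linear_scaleR_right] grad)
  have "((\<lambda>z. L z \<bullet> (M *v L z)) has_derivative f' z) (at z)" for z
  proof -
    have "((\<lambda>z. L z \<bullet> (M *v L z)) has_derivative
        (\<lambda>h. L z \<bullet> (M *v L h) + L h \<bullet> (M *v L z))) (at z)"
      by (intro has_derivative_inner bounded_linear_imp_has_derivative assms(1) grad)
    also have "(\<lambda>h. L z \<bullet> (M *v L h) + L h \<bullet> (M *v L z)) = f' z"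
      using symmetric_inner_commute[OF sym]
      by (auto simp: f'_def fun_eq_iff bounded_linear_Blinfun_apply[OF assms(1)] inner_commute)
    finally show ?thesis .
  qed
  moreover have "(f' has_derivative Blinfun f') (at z)" for z
    using bounded_linear_imp_has_derivative[OF lin]
    by (simp add: bounded_linear_Blinfun_apply[OF lin])
  ultimately show ?thesis
    unfolding twice_cont_differentiable_def
    by (intro exI[of _ f'] exI[of _ "\<lambda>_. Blinfun f'"]) auto
qed

lemma polynomial_growth_quadratic_form:
  fixes M :: "real^'n^'n" and L :: "'a::real_normed_vector \<Rightarrow> real^'n"
  assumes "bounded_linear L"
  shows "polynomial_growth (\<lambda>z. L z \<bullet> (M *v L z))"
proof -
  obtain c where c: "0 < c" "\<And>z. \<bar>L z \<bullet> (M *v L z)\<bar> \<le> c * (norm z)\<^sup>2"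
    using quadratic_form_bound[OF assms] by blast
  have "\<bar>L z \<bullet> (M *v L z)\<bar> \<le> c * (1 + (norm z)\<^sup>2)" for z
    using c(1) c(2)[of z] by (simp add: distrib_left)
  then show ?thesis
    unfolding polynomial_growth_def by blast
qed

lemma class_K_inf_linear:
  assumes "0 < c"
  shows "class_K_inf (\<lambda>s. c * s)"
  using assms unfolding class_K_inf_def
  by (auto intro!: continuous_intros strict_mono_onI
      filterlim_tendsto_pos_mult_at_top[OF tendsto_const] filterlim_ident)

lemma convex_concave_linear:
  fixes c :: real
  shows "convex_on {0..} (\<lambda>s. c * s)" and "concave_on {0..} (\<lambda>s. c * s)"
  by (auto simp: concave_on_def convex_on_def algebra_simps)

section \<open>The generator on a quadratic form of the error\<close>

lemma deriv_quadratic_form_line: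
  fixes M :: "real^'n^'n"
  assumes "transpose M = M"
  shows "deriv (\<lambda>t. (a + t *\<^sub>R v) \<bullet> (M *v (a + t *\<^sub>R v))) 0 = 2 * (v \<bullet> (M *v a))"
proof (rule DERIV_imp_deriv)
  have "((\<lambda>t. a \<bullet> (M *v a) + t * (2 * (v \<bullet> (M *v a))) + t^2 * (v \<bullet> (M *v v)))
      has_real_derivative 2 * (v \<bullet> (M *v a))) (at 0)"
    by (auto intro!: derivative_eq_intros)
  then show "((\<lambda>t. (a + t *\<^sub>R v) \<bullet> (M *v (a + t *\<^sub>R v)))
      has_real_derivative 2 * (v \<bullet> (M *v a))) (at 0)"
    by (simp add: quadratic_form_add[OF assms] matrix_vector_mult_scaleR power2_eq_square mult_ac)
qed

text \<open>
  The directions in which the error \<open>x - P y\<close> moves when one coordinate of the stacked vector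
  of \<open>x\<close> and \<open>y\<close> is increased. They let both kinds of partial derivatives, and hence the four
  blocks of the Hessian, be treated at once.
\<close>

definition error_direction :: "real^'k^'n \<Rightarrow> 'n + 'k \<Rightarrow> real^'n" where
  "error_direction P s = (case s of Inl i \<Rightarrow> axis i 1 | Inr j \<Rightarrow> - (P *v axis j 1))"

lemma error_step1: "x + t *\<^sub>R v - P *v y = (x - P *v y) + t *\<^sub>R v"
  for P :: "real^'k^'n"
  by simp

lemma error_step2: "x - P *v (y + t *\<^sub>R v) = (x - P *v y) + t *\<^sub>R - (P *v v)"
  for P :: "real^'k^'n"
  by (simp add: matrix_vector_right_distrib matrix_vector_mult_scaleR)

lemma partial_quadratic_error:
  fixes M :: "real^'n^'n" and P :: "real^'k^'n"
  assumes "transpose M = M"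
  shows "partial s (\<lambda>x y. (x - P *v y) \<bullet> (M *v (x - P *v y))) =
    (\<lambda>x y. 2 * (error_direction P s \<bullet> (M *v (x - P *v y))))"
  by (auto simp only: fun_eq_iff partial_def partial1_def partial2_def error_direction_def
      error_step1 error_step2 deriv_quadratic_form_line[OF assms] split: sum.split)

lemma deriv_linear_form_line:
  fixes M :: "real^'n^'n"
  shows "deriv (\<lambda>t. 2 * (b \<bullet> (M *v (a + t *\<^sub>R v)))) 0 = 2 * (b \<bullet> (M *v v))"
proof (rule DERIV_imp_deriv)
  have "((\<lambda>t. 2 * (b \<bullet> (M *v a)) + t * (2 * (b \<bullet> (M *v v))))
      has_real_derivative 2 * (b \<bullet> (M *v v))) (at 0)"
    by (auto intro!: derivative_eq_intros)
  then show "((\<lambda>t. 2 * (b \<bullet> (M *v (a + t *\<^sub>R v)))) has_real_derivative 2 * (b \<bullet> (M *v v))) (at 0)"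
    by (simp add: matrix_vector_right_distrib matrix_vector_mult_scaleR inner_add_right algebra_simps)
qed

lemma hessian_quadratic_error:
  fixes M :: "real^'n^'n" and P :: "real^'k^'n"
  assumes "transpose M = M"
  shows "hessian (\<lambda>x y. (x - P *v y) \<bullet> (M *v (x - P *v y))) x y =
    (\<chi> s t. 2 * (error_direction P t \<bullet> (M *v error_direction P s)))"
proof -
  have "partial s (\<lambda>x y. 2 * (b \<bullet> (M *v (x - P *v y)))) x y =
      2 * (b \<bullet> (M *v error_direction P s))" for s b
    by (auto simp only: partial_def partial1_def partial2_def error_direction_def
        error_step1 error_step2 deriv_linear_form_line split: sum.split)
  then show ?thesis
    by (simp add: hessian_def partial_quadratic_error[OF assms])
qed

lemma sum_UNIV_Plus:
  fixes f :: "'a::finite + 'b::finite \<Rightarrow> 'c::comm_monoid_add"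
  shows "(\<Sum>s\<in>UNIV. f s) = (\<Sum>i\<in>UNIV. f (Inl i)) + (\<Sum>j\<in>UNIV. f (Inr j))"
  by (simp add: UNIV_Plus_UNIV[symmetric] sum.Plus del: UNIV_Plus_UNIV)

lemma sum_axis_eq: "(\<Sum>i\<in>UNIV. a $ i *\<^sub>R axis i 1) = (a :: real^'n)"
  by (metis (no_types, lifting) basis_expansion scalar_mult_eq_scaleR sum.cong)

lemma sum_error_direction:
  fixes P :: "real^'k^'n"
  shows "(\<Sum>s\<in>UNIV. stack a b $ s *\<^sub>R error_direction P s) = a - P *v b"
proof -
  have "(\<Sum>j\<in>UNIV. b $ j *\<^sub>R (P *v axis j 1)) = P *v (\<Sum>j\<in>UNIV. b $ j *\<^sub>R axis j 1)"
    by (simp add: linear_sum[OF matrix_vector_mul_linear] matrix_vector_mult_scaleR)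
  then show ?thesis
    by (simp add: sum_UNIV_Plus stack_def error_direction_def sum_negf sum_axis_eq)
qed

lemma trace_rank_one_mult:
  fixes a :: "real^'s::finite"
  shows "trace ((columnvector a :: real^1^'s) ** (rowvector a :: real^'s^1) ** H) =
    (\<Sum>s\<in>UNIV. \<Sum>t\<in>UNIV. a $ s * a $ t * H $ t $ s)"
  by (simp add: trace_def matrix_matrix_mult_def columnvector_def rowvector_def)

text \<open>
  The Hessian is twice the Gram matrix of the error directions with respect to \<open>M\<close>. Tracing it
  against the rank-one matrix of the stacked vector therefore evaluates the quadratic form at the
  combination of error directions with the entries of that vector as coefficients.
\<close>

lemma trace_hessian_quadratic_error:
  fixes M :: "real^'n^'n" and P :: "real^'k^'n"
  assumes "transpose M = M"
  shows "1/2 * trace ((columnvector (stack a b) :: real^1^('n + 'k))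
      ** (rowvector (stack a b) :: real^('n + 'k)^1)
      ** hessian (\<lambda>x y. (x - P *v y) \<bullet> (M *v (x - P *v y))) x y) =
    (a - P *v b) \<bullet> (M *v (a - P *v b))"
proof -
  let ?d = "error_direction P"
  have "(a - P *v b) \<bullet> (M *v (a - P *v b)) =
      (\<Sum>s\<in>UNIV. \<Sum>t\<in>UNIV. stack a b $ s * stack a b $ t * (?d t \<bullet> (M *v ?d s)))"
    by (simp add: sum_error_direction[symmetric] linear_sum[OF matrix_vector_mul_linear]
        inner_sum_left inner_sum_right matrix_vector_mult_scaleR mult_ac sum_distrib_left)
  then show ?thesis
    by (simp add: trace_rank_one_mult hessian_quadratic_error[OF assms] sum_distrib_left mult_ac
        symmetric_inner_commute[OF assms])
qed

text \<open>
  \<open>V\<close> depends on both states only through the error, so its generator is that of the quadratic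
  form along the drift, diffusion and jump vectors of the error process.
\<close>

lemma generator_quadratic_error:
  fixes Sys :: "('n::finite, 'm::finite, 'p::finite, 'q::finite) jlss"
    and SysH :: "('k::finite, 'mh::finite, 'ph::finite, 'qh::finite) jlss"
    and M :: "real^'n^'n" and P :: "real^'k^'n"
  assumes sym: "transpose M = M"
  shows "generator N rate Sys SysH (\<lambda>x y. (x - P *v y) \<bullet> (M *v (x - P *v y))) x y u uh w wh =
    (let e = x - P *v y;
         drift = (A_mat Sys *v x + B_mat Sys *v u + D_mat Sys *v w)
           - P *v (A_mat SysH *v y + B_mat SysH *v uh + D_mat SysH *v wh);
         diffusion = E_mat Sys *v x - P *v (E_mat SysH *v y);
         jump = (\<lambda>i. R_mat Sys i *v x - P *v (R_mat SysH i *v y))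
     in 2 * (drift \<bullet> (M *v e)) + diffusion \<bullet> (M *v diffusion)
       + (\<Sum>i = 1..N. rate i * (2 * (jump i \<bullet> (M *v e)) + jump i \<bullet> (M *v jump i))))"
proof -
  let ?V = "\<lambda>x y. (x - P *v y) \<bullet> (M *v (x - P *v y))"
  let ?e = "x - P *v y"
  have "partial1 i ?V x y = 2 * (axis i 1 \<bullet> (M *v ?e))" for i
    using partial_quadratic_error[OF sym, of "Inl i" P]
    by (simp add: partial_def error_direction_def fun_eq_iff)
  then have p1: "(\<chi> i. partial1 i ?V x y) \<bullet> a = 2 * (a \<bullet> (M *v ?e))" for a
    by (simp add: inner_vec_def[of "vec_lambda _"] inner_axis' sum_distrib_left mult_ac
        inner_vec_def[of a])
  have p2': "partial2 j ?V x y = - 2 * ((P *v axis j 1) \<bullet> (M *v ?e))" for j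
    using partial_quadratic_error[OF sym, of "Inr j" P]
    by (simp add: partial_def error_direction_def fun_eq_iff)
  have p2: "(\<chi> j. partial2 j ?V x y) \<bullet> b = - 2 * ((P *v b) \<bullet> (M *v ?e))" for b
  proof -
    have "P *v b = (\<Sum>j\<in>UNIV. b $ j *\<^sub>R (P *v axis j 1))"
      by (subst sum_axis_eq[of b, symmetric])
         (simp only: linear_sum[OF matrix_vector_mul_linear] matrix_vector_mult_scaleR)
    then show ?thesis
      by (simp add: inner_vec_def[of "vec_lambda _"] p2' inner_sum_left sum_distrib_left
          mult_ac sum_negf)
  qed
  have jump: "?V (x + r) (y + rh) - ?V x y =
      2 * ((r - P *v rh) \<bullet> (M *v ?e)) + (r - P *v rh) \<bullet> (M *v (r - P *v rh))" for r rh
  proof -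
    have "x + r - P *v (y + rh) = ?e + (r - P *v rh)"
      by (simp add: matrix_vector_right_distrib)
    then show ?thesis
      by (simp only: quadratic_form_add[OF sym])
  qed
  show ?thesis
    unfolding generator_def p1 p2 jump trace_hessian_quadratic_error[OF sym] Let_def
    by (simp add: inner_diff_left[of _ _ "M *v ?e"])
qed


theorem theorem5p3:
  fixes Sys :: "('n::finite, 'm::finite, 'p::finite, 'q::finite) jlss"
    and SysH :: "('nh::finite, 'mh::finite, 'p, 'q) jlss"
    and N :: nat and rate :: "nat \<Rightarrow> real"
    and \<kappa> :: real
    and M :: "real^'n^'n" and K :: "real^'n^'m" and P :: "real^'nh^'n"
    and Q :: "real^'nh^'m" and S :: "real^'p^'m"
  defines "F \<equiv> A_mat Sys + B_mat Sys ** K + (\<Sum>i = 1..N. rate i *\<^sub>R R_mat Sys i)"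
  assumes "\<And>i. i \<in> {1..N} \<Longrightarrow> 0 < rate i"
    and "0 < \<kappa>"
    and "pos_definite M"
    and "transpose (C_mat Sys) ** C_mat Sys \<preceq> M"
    and "transpose F ** M + M ** F + transpose (E_mat Sys) ** M ** E_mat Sys
           + (\<Sum>i = 1..N. rate i *\<^sub>R (transpose (R_mat Sys i) ** M ** R_mat Sys i))
         \<preceq> - (\<kappa> *\<^sub>R M)"
    and "A_mat Sys ** P = P ** A_mat SysH - B_mat Sys ** Q"
    and "D_mat Sys = P ** D_mat SysH - B_mat Sys ** S"
    and "C_mat Sys ** P = C_mat SysH"
    and "E_mat Sys ** P = P ** E_mat SysH"
    and "\<And>i. i \<in> {1..N} \<Longrightarrow> R_mat Sys i ** P = P ** R_mat SysH i"
  shows "SSF_M2 N rate SysH Sys (\<lambda>x xh. (x - P *v xh) \<bullet> (M *v (x - P *v xh)))"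
proof -
  let ?V = "\<lambda>x xh. (x - P *v xh) \<bullet> (M *v (x - P *v xh))"
  let ?L = "\<lambda>z :: (real^'n) \<times> (real^'nh). fst z - P *v snd z"
  note matching = assms(7-11)
  have sym: "transpose M = M"
    using \<open>pos_definite M\<close> by (simp add: pos_definite_def)
  have L: "bounded_linear ?L"
    by (intro bounded_linear_sub bounded_linear_fst
        bounded_linear_compose[OF matrix_vector_mul_bounded_linear] bounded_linear_snd)
  have regular: "twice_cont_differentiable (\<lambda>(x, xh). ?V x xh)"
      "polynomial_growth (\<lambda>(x, xh). ?V x xh)"
    using twice_cont_differentiable_quadratic_form[OF L sym]
      polynomial_growth_quadratic_form[OF L, of M]
    by (simp_all add: case_prod_unfold)

  have output_bound: "(norm (C_mat Sys *v x - C_mat SysH *v xh))\<^sup>2 \<le> ?V x xh" for x xh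
  proof -
    let ?e = "x - P *v xh"
    have "C_mat Sys *v x - C_mat SysH *v xh = C_mat Sys *v ?e"
      by (simp add: matching(3)[symmetric] matrix_vector_mul_assoc[symmetric]
          matrix_vector_mult_diff_distrib)
    then have "(norm (C_mat Sys *v x - C_mat SysH *v xh))\<^sup>2 =
        ?e \<bullet> ((transpose (C_mat Sys) ** C_mat Sys) *v ?e)"
      using inner_congruence[of ?e "C_mat Sys" "mat 1"] by (simp add: power2_norm_eq_inner)
    also have "\<dots> \<le> ?V x xh"
      by (rule loewner_leD) fact
    finally show ?thesis .
  qed

  \<comment> \<open>The matrix inequality as a form in \<open>e\<close>, with the jump part of \<open>F\<close> moved to the jump terms.\<close>
  have dissipation:
    "2 * (((A_mat Sys + B_mat Sys ** K) *v e) \<bullet> (M *v e)) + (E_mat Sys *v e) \<bullet> (M *v (E_mat Sys *v e))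
      + (\<Sum>i = 1..N. rate i * (2 * ((R_mat Sys i *v e) \<bullet> (M *v e))
          + (R_mat Sys i *v e) \<bullet> (M *v (R_mat Sys i *v e))))
     \<le> - \<kappa> * (e \<bullet> (M *v e))" for e
  proof -
    have MF: "e \<bullet> ((transpose F ** M) *v e) = (F *v e) \<bullet> (M *v e)"
        "e \<bullet> ((M ** F) *v e) = (F *v e) \<bullet> (M *v e)"
      by (simp_all only: matrix_vector_mul_assoc[symmetric] vector_transpose_matrix
          dot_lmul_matrix[symmetric, of e "transpose F"] symmetric_inner_commute[OF sym, of e "F *v e"])
    have Fe: "(F *v e) \<bullet> (M *v e) = ((A_mat Sys + B_mat Sys ** K) *v e) \<bullet> (M *v e)
        + (\<Sum>i = 1..N. rate i * ((R_mat Sys i *v e) \<bullet> (M *v e)))"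
      by (simp add: F_def matrix_vector_mult_add_rdistrib sum_matrix_vector_mult inner_add_left inner_sum_left
          scaleR_matrix_vector_assoc[symmetric])
    have "e \<bullet> ((transpose F ** M + M ** F + transpose (E_mat Sys) ** M ** E_mat Sys
           + (\<Sum>i = 1..N. rate i *\<^sub>R (transpose (R_mat Sys i) ** M ** R_mat Sys i))) *v e)
         \<le> e \<bullet> ((- (\<kappa> *\<^sub>R M)) *v e)"
      by (rule loewner_leD) fact
    moreover have "(- (\<kappa> *\<^sub>R M)) *v e = - (\<kappa> *\<^sub>R (M *v e))"
      by (metis scaleR_matrix_vector_assoc scaleR_minus_left)
    ultimately show ?thesis
      by (simp add: matrix_vector_mult_add_rdistrib sum_matrix_vector_mult inner_add_right inner_sum_right MF Fe
          scaleR_matrix_vector_assoc[symmetric] inner_congruence distrib_left sum.distrib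
          sum_distrib_left mult_ac)
  qed

  obtain c where c: "0 < c" "\<And>z. \<bar>(D_mat Sys *v z) \<bullet> (M *v (D_mat Sys *v z))\<bar> \<le> c * (norm z)\<^sup>2"
    using quadratic_form_bound[OF matrix_vector_mul_bounded_linear] by blast
  obtain d where d: "0 < d"
      "\<And>z. \<bar>((P ** B_mat SysH) *v z) \<bullet> (M *v ((P ** B_mat SysH) *v z))\<bar> \<le> d * (norm z)\<^sup>2"
    using quadratic_form_bound[OF matrix_vector_mul_bounded_linear] by blast

  have decay: "\<exists>u. \<forall>w. generator N rate Sys SysH ?V x xh u uh w wh
      \<le> - (\<kappa> / 2 * ?V x xh) + 4 / \<kappa> * d * (norm uh)\<^sup>2 + 4 / \<kappa> * c * (norm (w - wh))\<^sup>2" for x xh uh wh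
  proof (intro exI allI)
    fix w
    let ?e = "x - P *v xh"
    \<comment> \<open>\<open>K\<close> stabilises the error; \<open>Q\<close> and \<open>S\<close> cancel what \<open>P\<close> fails to intertwine. The
      input may not depend on \<open>w\<close>, so \<open>S\<close> acts on \<open>wh\<close> and \<open>D (w - wh)\<close> is left over.\<close>
    let ?u = "K *v ?e + Q *v xh + S *v wh"
    let ?Dw = "D_mat Sys *v (w - wh)" and ?Bu = "(P ** B_mat SysH) *v uh"
    \<comment> \<open>The matching equations, solved for what the abstract dynamics contribute to the error.\<close>
    have PA: "P *v (A_mat SysH *v xh) = A_mat Sys *v (P *v xh) + B_mat Sys *v (Q *v xh)"
      using arg_cong[OF matching(1), of "\<lambda>X. X *v xh"]
      by (simp add: matrix_vector_mul_assoc matrix_vector_mult_diff_rdistrib)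
    have PD: "P *v (D_mat SysH *v wh) = D_mat Sys *v wh + B_mat Sys *v (S *v wh)"
      using arg_cong[OF matching(2), of "\<lambda>X. X *v wh"]
      by (simp add: matrix_vector_mul_assoc matrix_vector_mult_diff_rdistrib)
    have drift: "(A_mat Sys *v x + B_mat Sys *v ?u + D_mat Sys *v w)
        - P *v (A_mat SysH *v xh + B_mat SysH *v uh + D_mat SysH *v wh)
        = (A_mat Sys + B_mat Sys ** K) *v ?e + ?Dw - ?Bu"
      by (simp add: matrix_vector_right_distrib matrix_vector_mult_diff_distrib
          matrix_vector_mult_add_rdistrib PA PD matrix_vector_mul_assoc[symmetric])
    have diffusion: "E_mat Sys *v x - P *v (E_mat SysH *v xh) = E_mat Sys *v ?e"
      using arg_cong[OF matching(4), of "\<lambda>X. X *v xh"]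
      by (simp add: matrix_vector_mul_assoc matrix_vector_mult_diff_distrib)
    have jump: "R_mat Sys i *v x - P *v (R_mat SysH i *v xh) = R_mat Sys i *v ?e"
      if "i \<in> {1..N}" for i
      using arg_cong[OF matching(5)[OF that], of "\<lambda>X. X *v xh"]
      by (simp add: matrix_vector_mul_assoc matrix_vector_mult_diff_distrib)
    have "generator N rate Sys SysH ?V x xh ?u uh w wh =
        2 * (((A_mat Sys + B_mat Sys ** K) *v ?e) \<bullet> (M *v ?e))
        + (E_mat Sys *v ?e) \<bullet> (M *v (E_mat Sys *v ?e))
        + (\<Sum>i = 1..N. rate i * (2 * ((R_mat Sys i *v ?e) \<bullet> (M *v ?e))
            + (R_mat Sys i *v ?e) \<bullet> (M *v (R_mat Sys i *v ?e))))
        + 2 * (?Dw \<bullet> (M *v ?e)) + 2 * ((- ?Bu) \<bullet> (M *v ?e))"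
      unfolding generator_quadratic_error[OF sym] Let_def drift diffusion
      by (simp add: jump inner_add_left inner_diff_left)
    also have "\<dots> \<le> - \<kappa> * ?V x xh + 2 * (?Dw \<bullet> (M *v ?e)) + 2 * ((- ?Bu) \<bullet> (M *v ?e))"
      using dissipation[of ?e] by linarith
    also have "2 * (?Dw \<bullet> (M *v ?e)) \<le> \<kappa> / 4 * ?V x xh + 4 / \<kappa> * (c * (norm (w - wh))\<^sup>2)"
      using young_quadratic_form[OF \<open>pos_definite M\<close>, of "\<kappa> / 4" ?Dw ?e] \<open>0 < \<kappa>\<close>
        mult_left_mono[OF abs_le_D1[OF c(2)[of "w - wh"]], of "4 / \<kappa>"]
      by (simp add: mult.commute)
    also have "2 * ((- ?Bu) \<bullet> (M *v ?e)) \<le> \<kappa> / 4 * ?V x xh + 4 / \<kappa> * (d * (norm uh)\<^sup>2)"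
    proof -
      have "(- ?Bu) \<bullet> (M *v (- ?Bu)) = ?Bu \<bullet> (M *v ?Bu)"
        by (simp add: linear_neg[OF matrix_vector_mul_linear])
      then show ?thesis
        using young_quadratic_form[OF \<open>pos_definite M\<close>, of "\<kappa> / 4" "- ?Bu" ?e] \<open>0 < \<kappa>\<close>
          mult_left_mono[OF abs_le_D1[OF d(2)[of uh]], of "4 / \<kappa>"]
        by (simp add: mult.commute)
    qed
    finally show "generator N rate Sys SysH ?V x xh ?u uh w wh
        \<le> - (\<kappa> / 2 * ?V x xh) + 4 / \<kappa> * d * (norm uh)\<^sup>2 + 4 / \<kappa> * c * (norm (w - wh))\<^sup>2"
      by (simp add: algebra_simps)
  qed

  have linear_K: "class_K_inf (\<lambda>s. 1 * s)" "class_K_inf (\<lambda>s. \<kappa> / 2 * s)"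
      "class_K_inf (\<lambda>s. 4 / \<kappa> * d * s)" "class_K_inf (\<lambda>s. 4 / \<kappa> * c * s)"
    using \<open>0 < \<kappa>\<close> c(1) d(1) by (intro class_K_inf_linear; simp)+
  have nonneg: "\<forall>x xh. 0 \<le> ?V x xh"
    using pos_definite_inner_nonneg[OF \<open>pos_definite M\<close>] by blast
  show ?thesis
    unfolding SSF_M2_def
  proof (intro conjI nonneg regular, rule exI[of _ "\<lambda>s. 1 * s"], rule exI[of _ "\<lambda>s. \<kappa> / 2 * s"],
      rule exI[of _ "\<lambda>s. 4 / \<kappa> * d * s"], rule exI[of _ "\<lambda>s. 4 / \<kappa> * c * s"],
      intro conjI allI linear_K convex_concave_linear decay)
    show "1 * (norm (C_mat Sys *v x - C_mat SysH *v xh))\<^sup>2 \<le> ?V x xh" for x xh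
      using output_bound by simp
  qed
qed

end
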